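(* Let $A,B,C\in\mathcal{M}_n$ be positive definite matrices such that $C\ge A+B$, and let $0\le t\le1$. Then for all $j=1,2,\ldots,n$, $$\lambda_j\left(C+A^{\frac12}B^{\frac12}+B^{\frac12}A^{\frac12}\right)\le\lambda_j\left(C+A\sharp_{1-t}B+A\natural_tB\right).$$
   Context: $\mathcal{M}_n$ is the algebra of $n\times n$ complex matrices; $X\ge Y$ for Hermitian matrices means $X-Y$ is positive semidefinite. $\lambda_j(X)$ is the $j$-th eigenvalue of the Hermitian matrix $X$, arranged in decreasing order counting multiplicities. For positive definite $A,B$ and $0\le t\le1$: $A\sharp_t B:=A^{\frac12}\left(A^{-\frac12}BA^{-\frac12}\right)^{t}A^{\frac12}$ and $A\natural_t B:=A^{\frac12}\left(B^{\frac12}A^{-1}B^{\frac12}\right)^{t}A^{\frac12}$. *)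

theory Defs
  imports
    "Jordan_Normal_Form.Schur_Decomposition"
    "Jordan_Normal_Form.Gauss_Jordan_Elimination"
    "HOL-Computational_Algebra.Polynomial"
begin

text \<open>The algebra of \<open>n \<times> n\<close> complex matrices is \<open>carrier_mat n n\<close>. The predefined order
  \<open>\<le>\<close> on \<open>mat\<close> is entrywise, hence the separate definition of the order induced by positive
  semidefiniteness.\<close>

definition hermitian_mat :: "complex mat \<Rightarrow> bool" where
  "hermitian_mat A \<longleftrightarrow> square_mat A \<and> mat_adjoint A = A"

definition unitary_mat :: "complex mat \<Rightarrow> bool" where
  "unitary_mat U \<longleftrightarrow> square_mat U \<and>
     mat_adjoint U * U = 1\<^sub>m (dim_row U) \<and> U * mat_adjoint U = 1\<^sub>m (dim_row U)"

definition pos_semidef :: "complex mat \<Rightarrow> bool" where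
  "pos_semidef A \<longleftrightarrow> hermitian_mat A \<and>
     (\<forall>v \<in> carrier_vec (dim_row A). 0 \<le> Re ((A *\<^sub>v v) \<bullet>c v))"

definition pos_def :: "complex mat \<Rightarrow> bool" where
  "pos_def A \<longleftrightarrow> hermitian_mat A \<and>
     (\<forall>v \<in> carrier_vec (dim_row A). v \<noteq> 0\<^sub>v (dim_row A) \<longrightarrow> 0 < Re ((A *\<^sub>v v) \<bullet>c v))"

definition loewner_le :: "complex mat \<Rightarrow> complex mat \<Rightarrow> bool" (infix \<open>\<preceq>\<^sub>L\<close> 50) where
  "Y \<preceq>\<^sub>L X \<longleftrightarrow> pos_semidef (X - Y)"

text \<open>\<open>eigval_dec X j\<close> is the \<open>j\<close>-th eigenvalue of \<open>X\<close> (counting from 1) in decreasing order, where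
  the multiplicity is that of a root of the characteristic polynomial. It is meant for Hermitian
  \<open>X\<close> only: then all eigenvalues are real and \<open>Re\<close> does not lose information.\<close>

definition eigval_dec :: "complex mat \<Rightarrow> nat \<Rightarrow> real" where
  "eigval_dec X j = rev (sorted_list_of_multiset (image_mset Re (proots (char_poly X)))) ! (j - 1)"

text \<open>Functional calculus for Hermitian matrices: if \<open>A = U diag(d\<^sub>0, \<dots>, d\<^sub>n\<^sub>-\<^sub>1) U\<^sup>*\<close> with \<open>U\<close> unitary
  and \<open>d\<close> real, then \<open>f(A) = U diag(f d\<^sub>0, \<dots>, f d\<^sub>n\<^sub>-\<^sub>1) U\<^sup>*\<close>. The result depends neither on the chosen
  \<open>U\<close> nor on the order of the \<open>d\<^sub>i\<close>.\<close>

definition herm_fun :: "(real \<Rightarrow> real) \<Rightarrow> complex mat \<Rightarrow> complex mat" where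
  "herm_fun f A = (THE P. \<exists>U d. U \<in> carrier_mat (dim_row A) (dim_row A) \<and> unitary_mat U \<and>
     A = U * mat_diag (dim_row A) (\<lambda>i. complex_of_real (d i)) * mat_adjoint U \<and>
     P = U * mat_diag (dim_row A) (\<lambda>i. complex_of_real (f (d i))) * mat_adjoint U)"

text \<open>Real powers, used for positive definite matrices only.\<close>

definition mat_powr :: "complex mat \<Rightarrow> real \<Rightarrow> complex mat" (infixr \<open>powr\<^sub>m\<close> 80) where
  "A powr\<^sub>m r = herm_fun (\<lambda>x. x powr r) A"

text \<open>\<open>sharp_mean t A B\<close> is \<open>A \<sharp>\<^sub>t B\<close> and \<open>natural_mean t A B\<close> is \<open>A \<natural>\<^sub>t B\<close>. The inverse of an
  invertible \<open>A\<close> is \<open>the (mat_inverse A)\<close>.\<close>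

definition sharp_mean :: "real \<Rightarrow> complex mat \<Rightarrow> complex mat \<Rightarrow> complex mat" where
  "sharp_mean t A B =
     A powr\<^sub>m (1/2) * (A powr\<^sub>m (-1/2) * B * A powr\<^sub>m (-1/2)) powr\<^sub>m t * A powr\<^sub>m (1/2)"

definition natural_mean :: "real \<Rightarrow> complex mat \<Rightarrow> complex mat \<Rightarrow> complex mat" where
  "natural_mean t A B =
     A powr\<^sub>m (1/2) * (B powr\<^sub>m (1/2) * the (mat_inverse A) * B powr\<^sub>m (1/2)) powr\<^sub>m t * A powr\<^sub>m (1/2)"

end

theory Submission
  imports Defs
begin

text \<open>The two Hermitian matrices are already comparable in the Loewner order. With \<open>X = A\<^sup>1\<^sup>/\<^sup>2\<close>,
  \<open>Y = B\<^sup>1\<^sup>/\<^sup>2\<close> and \<open>T = Y X\<^sup>-\<^sup>1\<close>, the two means are \<open>X (T\<^sup>* T)\<^sup>1\<^sup>-\<^sup>t X\<close> and \<open>X (T T\<^sup>*)\<^sup>t X\<close>, while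
  \<open>X Y + Y X = X (T + T\<^sup>*) X\<close>. If \<open>T = V s W\<^sup>*\<close> is a singular value decomposition, then with
  \<open>P = V s\<^sup>t\<close> and \<open>Q = W s\<^sup>1\<^sup>-\<^sup>t\<close> one has \<open>T = P Q\<^sup>*\<close>, \<open>(T T\<^sup>*)\<^sup>t = P P\<^sup>*\<close> and \<open>(T\<^sup>* T)\<^sup>1\<^sup>-\<^sup>t = Q Q\<^sup>*\<close>, so the
  difference is \<open>X (P - Q) (P - Q)\<^sup>* X \<ge> 0\<close>. Weyl's monotonicity principle carries this over to the
  ordered eigenvalues.\<close>

section \<open>Adjoints and unitary matrices\<close>

lemma adjoint_index [simp]:
  fixes A :: "'a :: conjugatable_field mat"
  assumes "i < dim_col A" "j < dim_row A"
  shows "mat_adjoint A $$ (i, j) = conjugate (A $$ (j, i))"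
  using assms by (simp add: mat_adjoint_def mat_of_rows_def)

lemma adjoint_dim [simp]:
  fixes A :: "'a :: conjugatable_field mat"
  shows "dim_row (mat_adjoint A) = dim_col A" "dim_col (mat_adjoint A) = dim_row A"
  by (simp_all add: mat_adjoint_def)

lemma adjoint_carrier [simp]:
  fixes A :: "'a :: conjugatable_field mat"
  shows "A \<in> carrier_mat n m \<Longrightarrow> mat_adjoint A \<in> carrier_mat m n"
  by (rule carrier_matI) auto

lemma adjoint_adjoint [simp]: "mat_adjoint (mat_adjoint A) = (A :: complex mat)"
  by (rule eq_matI) auto

lemma adjoint_mult:
  fixes A B :: "complex mat"
  assumes "A \<in> carrier_mat n m" "B \<in> carrier_mat m k"
  shows "mat_adjoint (A * B) = mat_adjoint B * mat_adjoint A"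
proof (rule eq_matI)
  fix i j assume "i < dim_row (mat_adjoint B * mat_adjoint A)" "j < dim_col (mat_adjoint B * mat_adjoint A)"
  then have ij: "i < k" "j < n" using assms by auto
  then have "mat_adjoint (A * B) $$ (i, j) = (\<Sum>l<m. cnj (A $$ (j, l)) * cnj (B $$ (l, i)))"
    using assms by (simp add: scalar_prod_def atLeast0LessThan)
  also have "\<dots> = (\<Sum>l<m. cnj (B $$ (l, i)) * cnj (A $$ (j, l)))"
    by (simp only: mult.commute)
  also have "\<dots> = (mat_adjoint B * mat_adjoint A) $$ (i, j)"
    using assms ij by (simp add: scalar_prod_def atLeast0LessThan)
  finally show "mat_adjoint (A * B) $$ (i, j) = (mat_adjoint B * mat_adjoint A) $$ (i, j)" .
qed (use assms in auto)

lemma adjoint_add: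
  fixes A B :: "complex mat"
  assumes "A \<in> carrier_mat n m" "B \<in> carrier_mat n m"
  shows "mat_adjoint (A + B) = mat_adjoint A + mat_adjoint B"
  by (rule eq_matI) (use assms in auto)

lemma adjoint_minus:
  fixes A B :: "complex mat"
  assumes "A \<in> carrier_mat n m" "B \<in> carrier_mat n m"
  shows "mat_adjoint (A - B) = mat_adjoint A - mat_adjoint B"
  by (rule eq_matI) (use assms in auto)

lemma adjoint_one [simp]: "mat_adjoint (1\<^sub>m n :: complex mat) = 1\<^sub>m n"
  by (rule eq_matI) auto

abbreviation real_diag :: "nat \<Rightarrow> (nat \<Rightarrow> real) \<Rightarrow> complex mat" where
  "real_diag n d \<equiv> mat_diag n (\<lambda>i. complex_of_real (d i))"

lemma adjoint_real_diag [simp]: "mat_adjoint (real_diag n d) = real_diag n d"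
  by (rule eq_matI) (auto simp: mat_diag_def)

lemma adjoint_mult_vec:
  fixes A :: "complex mat"
  assumes "A \<in> carrier_mat n m" "v \<in> carrier_vec m" "w \<in> carrier_vec n"
  shows "(A *\<^sub>v v) \<bullet>c w = v \<bullet>c (mat_adjoint A *\<^sub>v w)"
proof -
  have "(A *\<^sub>v v) \<bullet>c w = (\<Sum>i<n. \<Sum>j<m. A $$ (i,j) * v $ j * cnj (w $ i))"
    using assms by (auto simp: scalar_prod_def sum_distrib_right atLeast0LessThan)
  also have "\<dots> = (\<Sum>j<m. \<Sum>i<n. A $$ (i,j) * v $ j * cnj (w $ i))"
    by (rule sum.swap)
  also have "\<dots> = v \<bullet>c (mat_adjoint A *\<^sub>v w)"
    using assms by (auto simp: scalar_prod_def sum_distrib_left atLeast0LessThan mult_ac intro!: sum.cong)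
  finally show ?thesis .
qed

lemma unitaryD:
  assumes "unitary_mat U" "U \<in> carrier_mat n n"
  shows "mat_adjoint U * U = 1\<^sub>m n" "U * mat_adjoint U = 1\<^sub>m n"
  using assms by (auto simp: unitary_mat_def)

text \<open>A left inverse of a square matrix is also a right inverse, so one of the two products
  suffices.\<close>

lemma unitaryI:
  assumes "U \<in> carrier_mat n n" "mat_adjoint U * U = 1\<^sub>m n"
  shows "unitary_mat U"
  using assms mat_mult_left_right_inverse[OF _ assms(1) assms(2)]
  by (auto simp: unitary_mat_def)

text \<open>Lets the simplifier cancel an inverse pair at the head of a right-associated
  product.\<close>

lemma mult_left_cancel_mat:
  fixes A B C :: "'a :: semiring_1 mat"
  assumes "A * B = 1\<^sub>m n" "A \<in> carrier_mat n m" "B \<in> carrier_mat m n" "C \<in> carrier_mat n k"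
  shows "A * (B * C) = C"
  using assms assoc_mult_mat[of A n m B n C k] by simp

text \<open>A normal form for products of square matrices: adjoints are pushed to the factors,
  brackets associate to the right, inverse pairs cancel. The size \<open>n\<close> is fixed at each
  use because the inner dimensions do not occur in the terms being rewritten.\<close>

lemmas square_mat_simps = assoc_mult_mat[of _ n n _ n _ n] mult_carrier_mat[of _ n n _ n]
  adjoint_mult[of _ n n _ n] right_mult_one_mat[of _ n n] left_mult_one_mat[of _ n n]
  mult_left_cancel_mat[of _ _ n n _ n] for n

lemma unitary_mult:
  assumes U: "U \<in> carrier_mat n n" and V: "V \<in> carrier_mat n n"
    and "unitary_mat U" "unitary_mat V"
  shows "unitary_mat (U * V)"
proof (rule unitaryI)
  have "mat_adjoint (U * V) * (U * V) = mat_adjoint V * (mat_adjoint U * (U * V))"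
    using U V by (simp add: square_mat_simps[where n = n])
  then show "mat_adjoint (U * V) * (U * V) = 1\<^sub>m n"
    using unitaryD[OF assms(4) V] unitaryD[OF assms(3) U] U V
    by (simp add: square_mat_simps[where n = n])
qed (use U V in auto)

section \<open>Spectral theorem and functional calculus\<close>

text \<open>Complete \<open>v\<close> to a basis and orthogonalise by Gram-Schmidt, which keeps the
  first vector. Scaling the columns to length one makes the matrix unitary; \<open>k\<close> is the
  scale factor of the first column.\<close>

lemma exists_unitary_first_col:
  fixes v :: "complex vec"
  assumes v: "v \<in> carrier_vec n" and v0: "v \<noteq> 0\<^sub>v n"
  shows "\<exists>U k. U \<in> carrier_mat n n \<and> unitary_mat U \<and> col U 0 = k \<cdot>\<^sub>v v"
proof -
  interpret cof_vec_space n "TYPE(complex)" .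
  define b where "b = basis_completion v"
  define ws where "ws = gram_schmidt n b"
  define W where "W = mat_of_cols n ws"
  from basis_completion[OF v v0, folded b_def]
  have dist_b: "distinct b" and indep: "\<not> lin_dep (set b)" and b: "set b \<subseteq> carrier_vec n"
    and hdb: "hd b = v" and len_b: "length b = n" by auto
  have n: "n \<noteq> 0" using v v0 by auto
  from hdb len_b n obtain vs where bv: "b = v # vs" by (cases b) auto
  from gram_schmidt_result[OF b dist_b indep refl, folded ws_def]
  have ws: "set ws \<subseteq> carrier_vec n" "corthogonal ws" "length ws = n"
    by (auto simp: len_b)
  from gram_schmidt_hd[OF v, of vs, folded bv] have hdws: "hd ws = v" unfolding ws_def .
  have orth_W: "corthogonal_mat W" using orthogonal_mat_of_cols ws unfolding W_def .
  have W: "W \<in> carrier_mat n n"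
    using ws unfolding W_def using mat_of_cols_carrier(1)[of n ws] by auto
  \<comment> \<open>Reciprocal length of column \<open>i\<close>: the columns of \<open>W\<close>
    are orthogonal but not yet normalised.\<close>
  define k where "k i = complex_of_real (1 / sqrt (Re (col W i \<bullet>c col W i)))" for i
  have diag: "diagonal_mat (mat_adjoint W * W)"
    using orth_W by (simp add: corthogonal_mat_def Let_def)
  have G: "(mat_adjoint W * W) $$ (i, i) = col W i \<bullet>c col W i" if "i < n" for i
    using that W by (auto simp: scalar_prod_def mult.commute intro!: sum.cong)
  have pos: "col W i \<bullet>c col W i > 0" if "i < n" for i
    using corthogonal_matD[OF orth_W, of i i] that W
    by (auto simp: less_le conjugate_square_ge_0_vec)
  define U where "U = W * mat_diag n k"
  have U: "U \<in> carrier_mat n n" using W by (simp add: U_def)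
  have adjk: "mat_adjoint (mat_diag n k) = mat_diag n k"
    by (rule eq_matI) (auto simp: mat_diag_def k_def)
  have "mat_adjoint U * U = mat_diag n k * (mat_adjoint W * W) * mat_diag n k"
    using W unfolding U_def
    by (simp add: adjk square_mat_simps[where n = n])
  also have "mat_adjoint W * W = mat_diag n (\<lambda>i. col W i \<bullet>c col W i)"
    using diag W G
    by (intro eq_matI) (auto simp: mat_diag_def diagonal_mat_def simp del: index_mult_mat(1))
  also have "mat_diag n k * mat_diag n (\<lambda>i. col W i \<bullet>c col W i) * mat_diag n k
    = mat_diag n (\<lambda>i. k i * (col W i \<bullet>c col W i) * k i)" by simp
  also have "\<dots> = 1\<^sub>m n"
  proof (rule eq_matI)
    fix i j assume ij: "i < dim_row (1\<^sub>m n :: complex mat)" "j < dim_col (1\<^sub>m n :: complex mat)"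
    obtain r where r: "col W j \<bullet>c col W j = complex_of_real r" "r > 0"
      using pos[of j] ij by (auto simp: less_complex_def complex_eq_iff)
    have "k j * (col W j \<bullet>c col W j) * k j = 1"
      using r by (simp add: k_def field_simps flip: of_real_mult)
    then show "mat_diag n (\<lambda>i. k i * (col W i \<bullet>c col W i) * k i) $$ (i, j) = 1\<^sub>m n $$ (i, j)"
      using ij by (auto simp: mat_diag_def)
  qed (auto simp: mat_diag_def)
  finally have un: "unitary_mat U" by (rule unitaryI[OF U])
  have "col W 0 = v" using ws hdws n unfolding W_def by (cases ws) (auto simp: col_mat_of_cols)
  then have "col U 0 = k 0 \<cdot>\<^sub>v v"
    using n W by (auto simp: U_def mat_diag_mult_right[OF W] mult.commute)
  with U un show ?thesis by blast
qed

section \<open>Unitary diagonalisation of Hermitian matrices\<close>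

lemma adjoint_four_block:
  fixes P :: "complex mat"
  assumes "P \<in> carrier_mat n n"
  shows "mat_adjoint (four_block_mat (1\<^sub>m 1) (0\<^sub>m 1 n) (0\<^sub>m n 1) P)
    = four_block_mat (1\<^sub>m 1) (0\<^sub>m 1 n) (0\<^sub>m n 1) (mat_adjoint P)"
  by (rule eq_matI) (use assms in auto)

lemma mult_diag_four_block:
  fixes D E :: "'a :: semiring_1 mat"
  assumes "A \<in> carrier_mat 1 1" "B \<in> carrier_mat 1 1" "D \<in> carrier_mat n n" "E \<in> carrier_mat n n"
  shows "four_block_mat A (0\<^sub>m 1 n) (0\<^sub>m n 1) D * four_block_mat B (0\<^sub>m 1 n) (0\<^sub>m n 1) E
    = four_block_mat (A * B) (0\<^sub>m 1 n) (0\<^sub>m n 1) (D * E)"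
  using assms by (subst mult_four_block_mat[of _ 1 1 _ n _ n _ _ 1 _ n]) auto

text \<open>\<open>case_nat e d\<close> is the sequence \<open>e, d 0, d 1, ...\<close>, that is,
  \<open>d\<close> with a new first entry.\<close>

lemma four_block_real_diag:
  "four_block_mat (real_diag 1 (\<lambda>_. e)) (0\<^sub>m 1 n) (0\<^sub>m n 1) (real_diag n d)
    = real_diag (Suc n) (case_nat e d)"
  by (rule eq_matI) (auto simp: mat_diag_def split: nat.split)

text \<open>Induction on the dimension. Conjugation by a unitary whose first column is an
  eigenvector clears the first column below the diagonal; being Hermitian, the result also has a
  cleared first row, and the remaining block is diagonalised by the induction hypothesis.\<close>

theorem hermitian_spectral:
  assumes "A \<in> carrier_mat n n" "hermitian_mat A"
  shows "\<exists>U d. U \<in> carrier_mat n n \<and> unitary_mat U \<and> A = U * real_diag n d * mat_adjoint U"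
  using assms
proof (induction n arbitrary: A)
  case 0
  have "A = 1\<^sub>m 0 * real_diag 0 (\<lambda>_. 0) * mat_adjoint (1\<^sub>m 0)"
    using 0 by (intro eq_matI) (auto simp: mat_diag_def)
  moreover have "unitary_mat (1\<^sub>m 0)" by (auto simp: unitary_mat_def)
  ultimately show ?case by (intro exI[of _ "1\<^sub>m 0"] exI[of _ "\<lambda>_. 0"] conjI one_carrier_mat)
next
  case (Suc n)
  let ?n = "Suc n"
  note A = Suc.prems(1)
  \<comment> \<open>The characteristic polynomial splits over the complex numbers and has positive
    degree, so an eigenvalue \<open>e\<close> exists.\<close>
  from char_poly_factorized[OF A] obtain as
    where as: "char_poly A = (\<Prod>a\<leftarrow>as. [:- a, 1:])" "length as = ?n" by blast
  then obtain e as' where "as = e # as'" by (cases as) auto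
  with as have "poly (char_poly A) e = 0" by simp
  then have "eigenvalue A e" using eigenvalue_root_char_poly[OF A] by simp
  then obtain v where v: "v \<in> carrier_vec ?n" "v \<noteq> 0\<^sub>v ?n" "A *\<^sub>v v = e \<cdot>\<^sub>v v"
    using A unfolding eigenvalue_def eigenvector_def by auto
  obtain U k where U: "U \<in> carrier_mat ?n ?n" and un: "unitary_mat U" and col: "col U 0 = k \<cdot>\<^sub>v v"
    using exists_unitary_first_col[OF v(1,2)] by blast
  note UU = unitaryD[OF un U]
  define A' where "A' = mat_adjoint U * (A * U)"
  have A': "A' \<in> carrier_mat ?n ?n" using U A by (simp add: A'_def square_mat_simps[where n = ?n])
  have adjA: "mat_adjoint A = A" using Suc.prems by (simp add: hermitian_mat_def)
  have adjA': "mat_adjoint A' = A'"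
    using U A by (simp add: A'_def square_mat_simps[where n = ?n] adjA)
  have herm: "cnj (A' $$ (j, i)) = A' $$ (i, j)" if "i < ?n" "j < ?n" for i j
    using arg_cong[OF adjA', of "\<lambda>M. M $$ (i, j)"] that A' by simp
  have "A *\<^sub>v col U 0 = e \<cdot>\<^sub>v col U 0"
    using v A by (simp add: col mult_mat_vec[of _ ?n ?n] smult_smult_assoc mult.commute)
  with col_mult2[OF A U zero_less_Suc] have colAU: "col (A * U) 0 = e \<cdot>\<^sub>v col U 0"
    by (rule trans)
  \<comment> \<open>Since \<open>A\<close> scales the first column of \<open>U\<close> by
    \<open>e\<close>, the first column of \<open>A'\<close> is \<open>e\<close> times that of
    \<open>mat_adjoint U * U = 1\<close>.\<close>
  have col0: "A' $$ (i, 0) = (if i = 0 then e else 0)" if "i < ?n" for i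
  proof -
    have "A' $$ (i, 0) = row (mat_adjoint U) i \<bullet> col (A * U) 0"
      using that U A unfolding A'_def by simp
    also have "\<dots> = e * (row (mat_adjoint U) i \<bullet> col U 0)"
      unfolding colAU using U that by simp
    also have "row (mat_adjoint U) i \<bullet> col U 0 = (mat_adjoint U * U) $$ (i, 0)"
      using U that by simp
    finally show ?thesis using that by (simp add: UU)
  qed
  have row0: "A' $$ (0, i) = (if i = 0 then e else 0)" if "i < ?n" for i
    using herm[of 0 i] herm[of 0 0] col0[OF that] col0[of 0] that by auto
  \<comment> \<open>\<open>e\<close> is a diagonal entry of a Hermitian matrix, hence equal to its
    own conjugate and real.\<close>
  define r where "r = Re e"
  have r: "e = complex_of_real r"
    using herm[of 0 0] col0[of 0] by (auto simp: r_def complex_eq_iff)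
  define A3 where "A3 = mat n n (\<lambda>(i, j). A' $$ (Suc i, Suc j))"
  have A3: "A3 \<in> carrier_mat n n" by (simp add: A3_def)
  have "hermitian_mat A3"
    unfolding hermitian_mat_def
  proof
    show "mat_adjoint A3 = A3"
      by (rule eq_matI) (use herm in \<open>auto simp: A3_def\<close>)
  qed (simp add: A3_def)
  from Suc.IH[OF A3 this] obtain P d where P: "P \<in> carrier_mat n n" and unP: "unitary_mat P"
    and A3P: "A3 = P * real_diag n d * mat_adjoint P" by blast
  \<comment> \<open>\<open>Q\<close> acts as \<open>P\<close> on the lower block and fixes the
    eigenvector direction already split off.\<close>
  define Q where "Q = four_block_mat (1\<^sub>m 1) (0\<^sub>m 1 n) (0\<^sub>m n 1) P"
  have Q: "Q \<in> carrier_mat ?n ?n" using P by (auto simp: Q_def)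
  have unQ: "unitary_mat Q"
    by (rule unitaryI[OF Q])
       (use P unitaryD[OF unP P] in
         \<open>simp add: Q_def adjoint_four_block mult_diag_four_block plus_1_eq_Suc del: One_nat_def\<close>)
  have "A' = four_block_mat (real_diag 1 (\<lambda>_. r)) (0\<^sub>m 1 n) (0\<^sub>m n 1) A3"
    by (rule eq_matI) (use A' col0 row0 r in \<open>auto simp: A3_def mat_diag_def\<close>)
  also have "\<dots> = Q * four_block_mat (real_diag 1 (\<lambda>_. r)) (0\<^sub>m 1 n) (0\<^sub>m n 1) (real_diag n d)
      * mat_adjoint Q"
    using P
    by (simp add: Q_def adjoint_four_block mult_diag_four_block A3P square_mat_simps[where n = n]
        left_mult_one_mat[of _ 1 1] right_mult_one_mat[of _ 1 1] del: One_nat_def)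
  finally have A'Q: "A' = Q * real_diag ?n (case_nat r d) * mat_adjoint Q"
    by (simp only: four_block_real_diag)
  have "A = U * A' * mat_adjoint U"
    using U A UU
    by (simp add: A'_def square_mat_simps[where n = ?n])
  also have "\<dots> = (U * Q) * real_diag ?n (case_nat r d) * mat_adjoint (U * Q)"
    using U Q by (simp add: A'Q square_mat_simps[where n = ?n])
  finally show ?case
    
    using unitary_mult[OF U Q un unQ] mult_carrier_mat[OF U Q]
    by (intro exI[of _ "U * Q"] exI[of _ "case_nat r d"] conjI)
qed

text \<open>\<open>herm_fun\<close> is a definite description, so two diagonalisations of
  \<open>A\<close> must be shown to give the same value. The transition matrix \<open>Z\<close>
  intertwines the two diagonals; hence its entry at \<open>(i, j)\<close> vanishes unless
  \<open>d j = e i\<close>, and so \<open>Z\<close> also intertwines their images under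
  \<open>f\<close>.\<close>

lemma herm_fun_diag:
  assumes U: "U \<in> carrier_mat n n" and "unitary_mat U"
  shows "herm_fun f (U * real_diag n d * mat_adjoint U)
    = U * real_diag n (\<lambda>i. f (d i)) * mat_adjoint U"
proof -
  define A where "A = U * real_diag n d * mat_adjoint U"
  have dimA: "dim_row A = n" using U by (simp add: A_def)
  note UU = unitaryD[OF assms(2,1)]
  have unique: "V * real_diag n (\<lambda>i. f (e i)) * mat_adjoint V
      = U * real_diag n (\<lambda>i. f (d i)) * mat_adjoint U"
    if V: "V \<in> carrier_mat n n" and un: "unitary_mat V"
      and eq: "A = V * real_diag n e * mat_adjoint V" for V e
  proof -
    note VV = unitaryD[OF un V]
    define Z where "Z = mat_adjoint V * U"
    have Z: "Z \<in> carrier_mat n n" using U V by (simp add: Z_def square_mat_simps[where n = n])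
    have "Z * real_diag n d = mat_adjoint V * A * U"
      using U V UU by (simp add: Z_def A_def square_mat_simps[where n = n])
    also have "\<dots> = real_diag n e * Z"
      using U V VV unfolding Z_def eq
      by (simp add: square_mat_simps[where n = n])
    finally have ZD: "Z * real_diag n d = real_diag n e * Z" .
    have "Z $$ (i, j) * d j = e i * Z $$ (i, j)" if "i < n" "j < n" for i j
      using that arg_cong[OF ZD, of "\<lambda>M. M $$ (i, j)"]
      by (simp add: mat_diag_mult_left[OF Z] mat_diag_mult_right[OF Z])
    then have "Z $$ (i, j) = 0 \<or> d j = e i" if "i < n" "j < n" for i j
      using that by fastforce
    then have "f (e i) * Z $$ (i, j) = Z $$ (i, j) * f (d j)" if "i < n" "j < n" for i j
      using that by fastforce
    then have comm: "real_diag n (\<lambda>i. f (e i)) * Z = Z * real_diag n (\<lambda>i. f (d i))"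
      unfolding mat_diag_mult_left[OF Z] mat_diag_mult_right[OF Z] by (intro eq_matI) auto
    have "mat_adjoint V = Z * mat_adjoint U"
      using U V UU by (simp add: Z_def square_mat_simps[where n = n])
    then have "V * real_diag n (\<lambda>i. f (e i)) * mat_adjoint V
        = V * (real_diag n (\<lambda>i. f (e i)) * Z) * mat_adjoint U"
      using U V Z by (simp add: square_mat_simps[where n = n])
    also have "\<dots> = V * (Z * real_diag n (\<lambda>i. f (d i))) * mat_adjoint U"
      by (simp only: comm)
    also have "\<dots> = U * real_diag n (\<lambda>i. f (d i)) * mat_adjoint U"
      using U V VV
      by (simp add: Z_def square_mat_simps[where n = n])
    finally show ?thesis .
  qed
  show ?thesis
    unfolding herm_fun_def A_def[symmetric] dimA
    by (rule the_equality) (use U assms(2) A_def unique in blast)+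
qed

section \<open>Weyl monotonicity of ordered eigenvalues\<close>

text \<open>Fewer than \<open>n\<close> linear conditions, padded with zero rows to a square matrix,
  give determinant zero and thus a nonzero kernel vector.\<close>

lemma exists_vec_annihilated:
  fixes vs :: "'a :: field vec list"
  assumes len: "length vs < n" and vs: "set vs \<subseteq> carrier_vec n"
  shows "\<exists>v \<in> carrier_vec n. v \<noteq> 0\<^sub>v n \<and> (\<forall>u \<in> set vs. u \<bullet> v = 0)"
proof -
  define c where "c i = (if i < length vs then vs ! i else 0\<^sub>v n)" for i
  define M where "M = mat\<^sub>r n n c"
  have c: "c i \<in> carrier_vec n" for i
    using vs by (auto simp: c_def)
  \<comment> \<open>Exhibits the first padding row as zero, in the shape that
    \<open>det_row_0\<close> expects.\<close>
  have "c = (\<lambda>i. if i = length vs then 0\<^sub>v n else c i)"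
    by (auto simp: c_def)
  then have "det M = 0"
    unfolding M_def using det_row_0[OF len, of c] c by simp
  then obtain v where v: "v \<in> carrier_vec n" "v \<noteq> 0\<^sub>v n" "M *\<^sub>v v = 0\<^sub>v n"
    using det_0_iff_vec_prod_zero_field[of M n] by (auto simp: M_def)
  have "vs ! i \<bullet> v = 0" if "i < length vs" for i
    using arg_cong[OF v(3), of "\<lambda>w. w $ i"] that len c[of i]
    by (simp add: M_def row_mat_of_row_fun) (simp add: c_def)
  with v show ?thesis by (metis in_set_conv_nth)
qed

text \<open>Moving \<open>U\<close> across the inner product diagonalises the quadratic form. As
  \<open>U\<close> ranges over all square matrices, \<open>d = 1\<close> gives
  \<open>U * mat_adjoint U\<close> the form of a squared norm.\<close>

lemma diag_form_inner:
  assumes U: "U \<in> carrier_mat n n" and v: "v \<in> carrier_vec n"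
  shows "Re ((U * real_diag n d * mat_adjoint U *\<^sub>v v) \<bullet>c v)
    = (\<Sum>i<n. d i * (cmod ((mat_adjoint U *\<^sub>v v) $ i))\<^sup>2)"
proof -
  define w where "w = mat_adjoint U *\<^sub>v v"
  have w: "w \<in> carrier_vec n" using U v by (simp add: w_def mult_mat_vec_carrier[of _ n n])
  have "(U * real_diag n d * mat_adjoint U *\<^sub>v v) \<bullet>c v = (U *\<^sub>v (real_diag n d *\<^sub>v w)) \<bullet>c v"
    using U v by (simp add: w_def square_mat_simps[where n = n] assoc_mult_mat_vec[of _ n n _ n]
        mult_mat_vec_carrier[of _ n n])
  also have "\<dots> = (real_diag n d *\<^sub>v w) \<bullet>c w"
    using U v w by (simp add: w_def adjoint_mult_vec[of _ n n] mult_mat_vec_carrier[of _ n n])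
  also have "real_diag n d *\<^sub>v w = vec n (\<lambda>i. d i * w $ i)"
  proof (rule eq_vecI)
    fix i assume "i < dim_vec (vec n (\<lambda>i. d i * w $ i))"
    then have i: "i < n" by simp
    have "(real_diag n d *\<^sub>v w) $ i = (\<Sum>j<n. (if i = j then complex_of_real (d j) else 0) * w $ j)"
      using i w by (simp add: mat_diag_def scalar_prod_def atLeast0LessThan)
    also have "\<dots> = (\<Sum>j<n. if i = j then d j * w $ j else 0)"
      by (rule sum.cong) auto
    finally show "(real_diag n d *\<^sub>v w) $ i = vec n (\<lambda>i. d i * w $ i) $ i"
      using i by simp
  qed (simp add: mat_diag_def)
  also have "Re (vec n (\<lambda>i. d i * w $ i) \<bullet>c w) = (\<Sum>i<n. d i * (cmod (w $ i))\<^sup>2)"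
    using w by (simp add: scalar_prod_def atLeast0LessThan cmod_power2)
      (simp add: power2_eq_square algebra_simps)
  finally show ?thesis by (simp add: w_def)
qed

text \<open>Parseval's identity, the case \<open>d = 1\<close> of the diagonal form.\<close>

lemma unitary_inner:
  assumes U: "U \<in> carrier_mat n n" and "unitary_mat U" and v: "v \<in> carrier_vec n"
  shows "Re (v \<bullet>c v) = (\<Sum>i<n. (cmod ((mat_adjoint U *\<^sub>v v) $ i))\<^sup>2)"
  using diag_form_inner[OF U v, of "\<lambda>_. 1"] unitaryD[OF assms(2) U] U v
  by (simp add: square_mat_simps[where n = n])

lemma inner_pos:
  fixes v :: "complex vec"
  assumes "v \<in> carrier_vec n" "v \<noteq> 0\<^sub>v n"
  shows "0 < Re (v \<bullet>c v)"
  using conjugate_square_greater_0_vec[OF assms(1)] assms(2) by (simp add: less_complex_def)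

text \<open>If \<open>X\<close> had more eigenvalues above \<open>c\<close> than \<open>Y\<close>, the linear conditions placing \<open>v\<close> in the
  span of the eigenvectors of \<open>X\<close> for eigenvalues \<open>\<ge> c\<close> and in that of \<open>Y\<close> for eigenvalues \<open>< c\<close>
  would number less than \<open>n\<close>, and a nonzero solution \<open>v\<close> violates the order of the quadratic forms.\<close>

lemma loewner_eigenvalue_count:
  assumes U: "U \<in> carrier_mat n n" "unitary_mat U" and V: "V \<in> carrier_mat n n" "unitary_mat V"
    and le: "U * real_diag n a * mat_adjoint U \<preceq>\<^sub>L V * real_diag n b * mat_adjoint V"
  shows "card {i. i < n \<and> c \<le> a i} \<le> card {i. i < n \<and> c \<le> b i}"
proof (rule ccontr)
  define X where "X = U * real_diag n a * mat_adjoint U"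
  define Y where "Y = V * real_diag n b * mat_adjoint V"
  assume "\<not> ?thesis"
  then have less: "card {i. i < n \<and> c \<le> b i} < card {i. i < n \<and> c \<le> a i}" by simp
  define ls where "ls = filter (\<lambda>i. a i < c) [0..<n]"
  define ks where "ks = filter (\<lambda>i. c \<le> b i) [0..<n]"
  have "length ks = card {i. i < n \<and> c \<le> b i}"
    by (simp add: ks_def length_filter_conv_card cong: conj_cong)
  moreover have "length ls = card {i. i < n \<and> a i < c}"
    by (simp add: ls_def length_filter_conv_card cong: conj_cong)
  \<comment> \<open>\<open>ls\<close> is the complement of the indices with
    \<open>c \<le> a i\<close>, so \<open>less\<close> leaves fewer than \<open>n\<close> conditions
    in total.\<close>
  moreover have "card {i. i < n \<and> a i < c} + card {i. i < n \<and> c \<le> a i}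
      = card ({i. i < n \<and> a i < c} \<union> {i. i < n \<and> c \<le> a i})"
    by (subst card_Un_disjoint) auto
  moreover have "{i. i < n \<and> a i < c} \<union> {i. i < n \<and> c \<le> a i} = {..<n}" by auto
  ultimately have len: "length ls + length ks < n" using less by simp
  define vs where "vs = map (row (mat_adjoint U)) ls @ map (row (mat_adjoint V)) ks"
  have "set vs \<subseteq> carrier_vec n"
    using U V by (auto simp: vs_def ls_def ks_def)
  with exists_vec_annihilated[of vs n] len obtain v where v: "v \<in> carrier_vec n" "v \<noteq> 0\<^sub>v n"
    and ann: "\<forall>u \<in> set vs. u \<bullet> v = 0" by (auto simp: vs_def)
  have u0: "(mat_adjoint U *\<^sub>v v) $ i = 0" if "i < n" "a i < c" for i
    using ann that U by (auto simp: vs_def ls_def)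
  have v0: "(mat_adjoint V *\<^sub>v v) $ i = 0" if "i < n" "c \<le> b i" for i
    using ann that V by (auto simp: vs_def ks_def)
  have "c * Re (v \<bullet>c v) = (\<Sum>i<n. c * (cmod ((mat_adjoint U *\<^sub>v v) $ i))\<^sup>2)"
    using unitary_inner[OF U v(1)] by (simp add: sum_distrib_left)
  also have "\<dots> \<le> (\<Sum>i<n. a i * (cmod ((mat_adjoint U *\<^sub>v v) $ i))\<^sup>2)"
  proof (rule sum_mono)
    fix i assume "i \<in> {..<n}"
    then show "c * (cmod ((mat_adjoint U *\<^sub>v v) $ i))\<^sup>2 \<le> a i * (cmod ((mat_adjoint U *\<^sub>v v) $ i))\<^sup>2"
      using u0[of i] by (cases "c \<le> a i") (auto intro: mult_right_mono)
  qed
  finally have lower: "c * Re (v \<bullet>c v) \<le> Re ((X *\<^sub>v v) \<bullet>c v)"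
    using diag_form_inner[OF U(1) v(1)] by (simp add: X_def)
  \<comment> \<open>A nonzero coordinate of \<open>v\<close> makes the upper bound strict: at that
    index \<open>b l < c\<close>, because the coordinates with \<open>c \<le> b l\<close> were made
    to vanish.\<close>
  have "\<exists>i<n. (mat_adjoint V *\<^sub>v v) $ i \<noteq> 0"
  proof (rule ccontr)
    assume "\<not> ?thesis"
    then have "Re (v \<bullet>c v) = 0" using unitary_inner[OF V v(1)] by simp
    with inner_pos[OF v] show False by simp
  qed
  then obtain l where l: "l < n" "(mat_adjoint V *\<^sub>v v) $ l \<noteq> 0" by blast
  have "(\<Sum>i<n. b i * (cmod ((mat_adjoint V *\<^sub>v v) $ i))\<^sup>2)
      < (\<Sum>i<n. c * (cmod ((mat_adjoint V *\<^sub>v v) $ i))\<^sup>2)"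
  proof (rule sum_strict_mono_ex1)
    show "\<forall>i\<in>{..<n}. b i * (cmod ((mat_adjoint V *\<^sub>v v) $ i))\<^sup>2
        \<le> c * (cmod ((mat_adjoint V *\<^sub>v v) $ i))\<^sup>2"
    proof
      fix i assume "i \<in> {..<n}"
      then show "b i * (cmod ((mat_adjoint V *\<^sub>v v) $ i))\<^sup>2 \<le> c * (cmod ((mat_adjoint V *\<^sub>v v) $ i))\<^sup>2"
        using v0[of i] by (cases "c \<le> b i") (auto intro: mult_right_mono)
    qed
    have "b l < c" using v0[of l] l by force
    with l show "\<exists>i\<in>{..<n}. b i * (cmod ((mat_adjoint V *\<^sub>v v) $ i))\<^sup>2
        < c * (cmod ((mat_adjoint V *\<^sub>v v) $ i))\<^sup>2"
      by (intro bexI[of _ l]) auto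
  qed simp
  also have "\<dots> = c * Re (v \<bullet>c v)"
    using unitary_inner[OF V v(1)] by (simp add: sum_distrib_left)
  finally have upper: "Re ((Y *\<^sub>v v) \<bullet>c v) < c * Re (v \<bullet>c v)"
    using diag_form_inner[OF V(1) v(1)] by (simp add: Y_def)
  have X: "X \<in> carrier_mat n n" and Y: "Y \<in> carrier_mat n n"
    using U V by (simp_all add: X_def Y_def square_mat_simps[where n = n])
  have "0 \<le> Re (((Y - X) *\<^sub>v v) \<bullet>c v)"
    using le X Y v(1) unfolding loewner_le_def pos_semidef_def X_def[symmetric] Y_def[symmetric]
    by auto
  also have "(Y - X) *\<^sub>v v = Y *\<^sub>v v - X *\<^sub>v v"
    using X Y v(1) by (simp add: minus_mult_distrib_mat_vec[of _ n n])
  also have "Re ((Y *\<^sub>v v - X *\<^sub>v v) \<bullet>c v) = Re ((Y *\<^sub>v v) \<bullet>c v) - Re ((X *\<^sub>v v) \<bullet>c v)"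
    using X Y v(1) by (simp add: minus_scalar_prod_distrib[of _ n] mult_mat_vec_carrier[of _ n n])
  finally show False using lower upper by simp
qed

text \<open>Similar matrices share their characteristic polynomial, and that of a diagonal matrix is
  the product of the linear factors of its entries. So the multiset of roots consists of the
  \<open>d i\<close>, and \<open>Re\<close> only undoes the embedding of the reals.\<close>

lemma eigval_dec_diag_form:
  assumes U: "U \<in> carrier_mat n n" "unitary_mat U"
  shows "eigval_dec (U * real_diag n d * mat_adjoint U) j = rev (sort (map d [0..<n])) ! (j - 1)"
proof -
  have "similar_mat_wit (U * real_diag n d * mat_adjoint U) (real_diag n d) U (mat_adjoint U)"
    by (rule similar_mat_witI[of _ _ n])
       (use U unitaryD[OF U(2,1)] in \<open>simp_all add: square_mat_simps[where n = n]\<close>)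
  then have "similar_mat (U * real_diag n d * mat_adjoint U) (real_diag n d)"
    unfolding similar_mat_def by blast
  then have "char_poly (U * real_diag n d * mat_adjoint U) = char_poly (real_diag n d)"
    by (rule char_poly_similar)
  also have "\<dots> = (\<Prod>a\<leftarrow>diag_mat (real_diag n d). [:- a, 1:])"
    by (rule char_poly_upper_triangular[of _ n]) (auto simp: mat_diag_def)
  also have "diag_mat (real_diag n d) = map (\<lambda>i. complex_of_real (d i)) [0..<n]"
    by (auto simp: diag_mat_def mat_diag_def)
  finally have "char_poly (U * real_diag n d * mat_adjoint U)
      = (\<Prod>a\<leftarrow>map (\<lambda>i. complex_of_real (d i)) [0..<n]. [:- a, 1:])" .
  moreover have "proots (\<Prod>a\<leftarrow>as. [:- a, 1:]) = mset as" for as :: "complex list"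
  proof (induction as)
    case (Cons a as)
    have "(\<Prod>a\<leftarrow>as. [:- a, 1:]) \<noteq> 0" by auto
    then have "proots ([:- a, 1:] * (\<Prod>a\<leftarrow>as. [:- a, 1:])) = proots [:- a, 1:] + mset as"
      by (subst proots_mult) (use Cons in auto)
    then show ?case by simp
  qed simp
  ultimately have "image_mset Re (proots (char_poly (U * real_diag n d * mat_adjoint U)))
      = mset (map d [0..<n])"
    by (simp only: mset_map[symmetric]) (simp add: comp_def)
  then show ?thesis
    unfolding eigval_dec_def by (simp only: sorted_list_of_multiset_mset)
qed

text \<open>In a decreasing list the entry at index \<open>k\<close>, counted from 0, reaches
  \<open>c\<close> exactly if at least \<open>k + 1\<close> entries do. Comparing the counts for
  every threshold therefore compares the sorted lists entrywise.\<close>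

lemma rev_sort_nth_mono:
  fixes xs ys :: "'a :: linorder list"
  assumes "length xs = length ys" "k < length xs"
    and le: "\<And>c. length (filter (\<lambda>x. c \<le> x) xs) \<le> length (filter (\<lambda>x. c \<le> x) ys)"
  shows "rev (sort xs) ! k \<le> rev (sort ys) ! k"
proof (rule ccontr)
  have count: "length (filter P xs) = card {i. i < length xs \<and> P (rev (sort xs) ! i)}"
    for P and xs :: "'a list"
  proof -
    have "length (filter P xs) = size (filter_mset P (mset (rev (sort xs))))"
      by (simp flip: mset_filter)
    also have "\<dots> = length (filter P (rev (sort xs)))"
      by (simp only: size_mset mset_filter[symmetric])
    finally show ?thesis by (simp add: length_filter_conv_card)
  qed
  have anti: "rev (sort xs) ! j \<le> rev (sort xs) ! i" if "i \<le> j" "j < length xs" for i j and xs :: "'a list"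
    using that by (auto simp: rev_nth intro!: sorted_nth_mono)
  define c where "c = rev (sort xs) ! k"
  assume "\<not> ?thesis"
  then have less: "rev (sort ys) ! k < c" by (simp add: c_def)
  \<comment> \<open>With \<open>c\<close> the entry of \<open>xs\<close> at \<open>k\<close>, the
    indices \<open>0\<close> to \<open>k\<close> of \<open>xs\<close> all reach \<open>c\<close>,
    whereas in \<open>ys\<close> only indices below \<open>k\<close> can.\<close>
  have "card {..k} \<le> card {i. i < length xs \<and> c \<le> rev (sort xs) ! i}"
    using assms anti[of _ k xs] by (intro card_mono) (auto simp: c_def)
  also have "\<dots> \<le> card {i. i < length ys \<and> c \<le> rev (sort ys) ! i}"
    using le[of c] by (simp only: count)
  also have "\<dots> \<le> card {..<k}"
  proof (rule card_mono)
    show "{i. i < length ys \<and> c \<le> rev (sort ys) ! i} \<subseteq> {..<k}"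
      using less anti[of k _ ys] by (force simp: not_less[symmetric])
  qed simp
  finally show False by simp
qed

text \<open>Weyl's principle: after diagonalising both matrices, the eigenvalue counts above each
  threshold order the sorted eigenvalues.\<close>

theorem eigval_dec_mono:
  assumes X: "X \<in> carrier_mat n n" "hermitian_mat X" and Y: "Y \<in> carrier_mat n n" "hermitian_mat Y"
    and le: "X \<preceq>\<^sub>L Y" and j: "j \<in> {1..n}"
  shows "eigval_dec X j \<le> eigval_dec Y j"
proof -
  obtain U a where U: "U \<in> carrier_mat n n" "unitary_mat U" and XU: "X = U * real_diag n a * mat_adjoint U"
    using hermitian_spectral[OF X] by blast
  obtain V b where V: "V \<in> carrier_mat n n" "unitary_mat V" and YV: "Y = V * real_diag n b * mat_adjoint V"
    using hermitian_spectral[OF Y] by blast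
  have "length (filter (\<lambda>x. c \<le> x) (map a [0..<n])) \<le> length (filter (\<lambda>x. c \<le> x) (map b [0..<n]))" for c
    using loewner_eigenvalue_count[OF U V le[unfolded XU YV], of c]
    by (simp add: length_filter_conv_card cong: conj_cong)
  then show ?thesis
    unfolding XU YV eigval_dec_diag_form[OF U] eigval_dec_diag_form[OF V]
    using j by (intro rev_sort_nth_mono) auto
qed

section \<open>Positive definite matrices and singular values\<close>

lemma mat_diag_cong: "(\<And>i. i < n \<Longrightarrow> f i = g i) \<Longrightarrow> mat_diag n f = mat_diag n g"
  by (rule eq_matI) (auto simp: mat_diag_def)

lemma mult_mat_zero_vec:
  fixes A :: "'a :: semiring_0 mat"
  assumes "A \<in> carrier_mat n m"
  shows "A *\<^sub>v 0\<^sub>v m = 0\<^sub>v n"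
  by (rule eq_vecI) (use assms in \<open>auto simp: scalar_prod_right_zero[of _ m]\<close>)

lemma herm_fun_hermitian:
  assumes "A \<in> carrier_mat n n" "hermitian_mat A"
  shows "herm_fun f A \<in> carrier_mat n n" "mat_adjoint (herm_fun f A) = herm_fun f A"
proof -
  obtain U d where U: "U \<in> carrier_mat n n" "unitary_mat U" and A: "A = U * real_diag n d * mat_adjoint U"
    using hermitian_spectral[OF assms] by blast
  show "herm_fun f A \<in> carrier_mat n n" "mat_adjoint (herm_fun f A) = herm_fun f A"
    using U(1) unfolding A herm_fun_diag[OF U] by (simp_all add: square_mat_simps[where n = n])
qed

section \<open>Positivity, square roots and inverses\<close>

lemma pos_semidef_mult_adjoint:
  assumes R: "R \<in> carrier_mat n n"
  shows "pos_semidef (R * mat_adjoint R)"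
proof -
  have "0 \<le> Re ((R * mat_adjoint R *\<^sub>v v) \<bullet>c v)" if v: "v \<in> carrier_vec n" for v
    using diag_form_inner[OF R v, of "\<lambda>_. 1"] R
    by (simp add: square_mat_simps[where n = n] sum_nonneg)
  moreover have "mat_adjoint (R * mat_adjoint R) = R * mat_adjoint R"
    using R by (simp add: square_mat_simps[where n = n])
  ultimately show ?thesis
    using R by (simp add: pos_semidef_def hermitian_mat_def)
qed

text \<open>The matrix form of \<open>2ab \<le> a^2 + b^2\<close>: the difference of the sides is
  \<open>(P - Q) * mat_adjoint (P - Q)\<close>.\<close>

lemma adjoint_am_gm:
  assumes P: "P \<in> carrier_mat n n" and Q: "Q \<in> carrier_mat n n"
  shows "P * mat_adjoint Q + Q * mat_adjoint P \<preceq>\<^sub>L P * mat_adjoint P + Q * mat_adjoint Q"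
proof -
  have "(P - Q) * mat_adjoint (P - Q)
      = (P * mat_adjoint P - Q * mat_adjoint P) - (P * mat_adjoint Q - Q * mat_adjoint Q)"
    using P Q by (simp add: adjoint_minus[of _ n n] mult_minus_distrib_mat[of _ n n _ n] minus_carrier_mat[of _ n n]
        minus_mult_distrib_mat[of _ n n _ _ n])
  also have "\<dots> = P * mat_adjoint P + Q * mat_adjoint Q - (P * mat_adjoint Q + Q * mat_adjoint P)"
    by (rule eq_matI) (use P Q in \<open>auto simp del: index_mult_mat(1)\<close>)
  finally show ?thesis
    unfolding loewner_le_def using pos_semidef_mult_adjoint[OF minus_carrier_mat[OF Q], of P] by simp
qed

text \<open>Column \<open>i\<close> of \<open>U\<close> is a unit eigenvector, at which the
  quadratic form takes the value \<open>d i\<close>.\<close>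

lemma pos_def_diag_form_pos:
  assumes U: "U \<in> carrier_mat n n" "unitary_mat U"
    and pos: "pos_def (U * real_diag n d * mat_adjoint U)" and i: "i < n"
  shows "0 < d i"
proof -
  define v where "v = col U i"
  have v: "v \<in> carrier_vec n" using U i by (simp add: v_def)
  have "mat_adjoint U *\<^sub>v v = col (mat_adjoint U * U) i"
    using U i by (simp add: v_def col_mult2[of _ n n _ n])
  then have e: "mat_adjoint U *\<^sub>v v = unit_vec n i"
    using unitaryD[OF U(2,1)] i by simp
  have "v \<noteq> 0\<^sub>v n"
  proof
    assume "v = 0\<^sub>v n"
    then have "unit_vec n i = (0\<^sub>v n :: complex vec)" using e U by (simp add: mult_mat_zero_vec[of _ n n])
    then show False using i by simp
  qed
  then have "0 < Re ((U * real_diag n d * mat_adjoint U *\<^sub>v v) \<bullet>c v)"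
    using pos v U by (simp add: pos_def_def)
  also have "\<dots> = (\<Sum>l<n. if l = i then d l else 0)"
    unfolding diag_form_inner[OF U(1) v] e by (rule sum.cong) (auto simp: unit_vec_def)
  finally show ?thesis using i by simp
qed

lemma pos_def_spectral:
  assumes "A \<in> carrier_mat n n" "pos_def A"
  obtains U d where "U \<in> carrier_mat n n" "unitary_mat U" "A = U * real_diag n d * mat_adjoint U"
    "\<And>i. i < n \<Longrightarrow> 0 < d i"
  using hermitian_spectral[OF assms(1)] pos_def_diag_form_pos assms(2)
  unfolding pos_def_def by metis

text \<open>All powers of \<open>A\<close> are diagonal in one common unitary basis, so exponents
  add; here the sums are 1 and 0.\<close>

lemma mat_powr_half:
  assumes A: "A \<in> carrier_mat n n" "pos_def A"
  shows "A powr\<^sub>m (1/2) * A powr\<^sub>m (1/2) = A"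
    and "A powr\<^sub>m (1/2) * A powr\<^sub>m (-1/2) = 1\<^sub>m n"
    and "A powr\<^sub>m (-1/2) * A powr\<^sub>m (1/2) = 1\<^sub>m n"
proof -
  obtain U d where U: "U \<in> carrier_mat n n" "unitary_mat U" and eq: "A = U * real_diag n d * mat_adjoint U"
    and pos: "\<And>i. i < n \<Longrightarrow> 0 < d i"
    using pos_def_spectral[OF A] by blast
  have mult: "A powr\<^sub>m r * A powr\<^sub>m s = U * real_diag n (\<lambda>i. d i powr (r + s)) * mat_adjoint U" for r s
  proof -
    have "A powr\<^sub>m r * A powr\<^sub>m s
        = U * (real_diag n (\<lambda>i. d i powr r) * (mat_adjoint U * (U * (real_diag n (\<lambda>i. d i powr s) * mat_adjoint U))))"
      using U unfolding mat_powr_def eq herm_fun_diag[OF U] by (simp add: square_mat_simps[where n = n])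
    also have "\<dots> = U * (real_diag n (\<lambda>i. d i powr r) * real_diag n (\<lambda>i. d i powr s)) * mat_adjoint U"
      using U unitaryD[OF U(2,1)] by (simp add: square_mat_simps[where n = n] del: mat_diag_diag)
    finally show ?thesis by (simp add: powr_add)
  qed
  have "real_diag n (\<lambda>i. d i powr 1) = real_diag n d"
    using pos by (intro mat_diag_cong) (simp add: less_imp_le)
  then show "A powr\<^sub>m (1/2) * A powr\<^sub>m (1/2) = A"
    using mult[of "1/2" "1/2"] by (simp add: eq[symmetric])
  \<comment> \<open>Positivity of the \<open>d i\<close> matters, since
    \<open>0 powr 0 = 0\<close>.\<close>
  have "real_diag n (\<lambda>i. d i powr 0) = real_diag n (\<lambda>_. 1)"
    using pos by (intro mat_diag_cong) (simp add: less_imp_neq[symmetric])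
  then show "A powr\<^sub>m (1/2) * A powr\<^sub>m (-1/2) = 1\<^sub>m n" "A powr\<^sub>m (-1/2) * A powr\<^sub>m (1/2) = 1\<^sub>m n"
    using U unitaryD[OF U(2,1)] by (simp_all add: mult square_mat_simps[where n = n])
qed

text \<open>\<open>A\<close> is a unit of the matrix ring, which excludes \<open>None\<close>;
  uniqueness of inverses identifies the matrix returned.\<close>

lemma the_mat_inverse:
  fixes A :: "'a :: field mat"
  assumes A: "A \<in> carrier_mat n n" and B: "B \<in> carrier_mat n n"
    and AB: "A * B = 1\<^sub>m n" and BA: "B * A = 1\<^sub>m n"
  shows "the (mat_inverse A) = B"
proof (cases "mat_inverse A")
  case None
  have "A \<in> Units (ring_mat TYPE('a) n ())"
    using assms by (auto simp: Units_def ring_mat_def)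
  with mat_inverse(1)[OF A None, of "()"] show ?thesis by blast
next
  case (Some C)
  from mat_inverse(2)[OF A Some] have C: "A * C = 1\<^sub>m n" "C \<in> carrier_mat n n" by auto
  have "C = B * (A * C)" using mult_left_cancel_mat[OF BA B A C(2)] by simp
  then show ?thesis using C B Some by simp
qed

text \<open>The left inverse \<open>S\<close> makes \<open>T\<close> injective, so
  \<open>mat_adjoint T * T\<close> is positive definite. Its eigenvectors form \<open>W\<close> and
  the roots of its eigenvalues are the singular values; as these are positive, \<open>V\<close> is
  found by dividing by them.\<close>

lemma singular_value_decomposition:
  assumes T: "T \<in> carrier_mat n n" and S: "S \<in> carrier_mat n n" and inv: "S * T = 1\<^sub>m n"
  obtains V W s where "V \<in> carrier_mat n n" "unitary_mat V" "W \<in> carrier_mat n n" "unitary_mat W"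
    "T = V * real_diag n s * mat_adjoint W" "\<And>i. i < n \<Longrightarrow> 0 < s i"
proof -
  note simps = square_mat_simps[where n = n]
  define M where "M = mat_adjoint T * T"
  have M: "M \<in> carrier_mat n n" using T by (simp add: M_def simps)
  have "0 < Re ((M *\<^sub>v v) \<bullet>c v)" if v: "v \<in> carrier_vec n" "v \<noteq> 0\<^sub>v n" for v
  proof -
    have "S *\<^sub>v (T *\<^sub>v v) = v"
      using assoc_mult_mat_vec[OF S T v(1)] inv v by simp
    then have "T *\<^sub>v v \<noteq> 0\<^sub>v n" using v S by (auto simp: mult_mat_zero_vec[of _ n n])
    then have "0 < Re ((T *\<^sub>v v) \<bullet>c (T *\<^sub>v v))"
      using T v by (intro inner_pos[of _ n]) (auto simp: mult_mat_vec_carrier[of _ n n])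
    also have "(T *\<^sub>v v) \<bullet>c (T *\<^sub>v v) = (M *\<^sub>v v) \<bullet>c v"
      using T v adjoint_mult_vec[of "mat_adjoint T" n n "T *\<^sub>v v" v]
      by (simp add: M_def assoc_mult_mat_vec[of _ n n _ n] mult_mat_vec_carrier[of _ n n])
    finally show ?thesis .
  qed
  moreover have "mat_adjoint M = M" using T by (simp add: M_def simps)
  ultimately have "pos_def M" using M by (simp add: pos_def_def hermitian_mat_def)
  then obtain W d where W: "W \<in> carrier_mat n n" "unitary_mat W"
    and MW: "M = W * real_diag n d * mat_adjoint W" and pos: "\<And>i. i < n \<Longrightarrow> 0 < d i"
    using pos_def_spectral[OF M] by blast
  note WW = unitaryD[OF W(2,1)]
  define s where "s i = sqrt (d i)" for i
  \<comment> \<open>The inverse of the diagonal matrix of singular values; the desired factorisation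
    forces \<open>V = T * (W * E)\<close>.\<close>
  define E where "E = real_diag n (\<lambda>i. 1 / s i)"
  have E: "E \<in> carrier_mat n n" "mat_adjoint E = E"
    unfolding E_def by (simp_all only: mat_diag_dim adjoint_real_diag)
  have "E * (real_diag n d * E) = real_diag n (\<lambda>i. 1 / s i * (d i * (1 / s i)))"
    by (simp add: E_def)
  also have "\<dots> = mat_diag n (\<lambda>_. 1)"
  proof (rule mat_diag_cong)
    fix i assume "i < n"
    then have "1 / s i * (d i * (1 / s i)) = 1"
      using pos[of i] by (simp add: s_def field_simps)
    then show "complex_of_real (1 / s i * (d i * (1 / s i))) = 1" by (simp only: of_real_1)
  qed
  finally have EdE: "E * (real_diag n d * E) = 1\<^sub>m n" by simp
  have "E * real_diag n s = mat_diag n (\<lambda>_. 1)"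
    unfolding mat_diag_diag E_def
  proof (rule mat_diag_cong)
    fix i assume "i < n"
    then show "complex_of_real (1 / s i) * complex_of_real (s i) = 1"
      using pos[of i] by (simp add: s_def)
  qed
  then have Es: "E * real_diag n s = 1\<^sub>m n" by simp
  define V where "V = T * (W * E)"
  have V: "V \<in> carrier_mat n n" using T W E by (simp add: V_def simps)
  have "mat_adjoint V * V = E * (mat_adjoint W * (M * (W * E)))"
    using T W E by (simp add: V_def M_def simps)
  also have "\<dots> = E * (real_diag n d * E)"
    using W WW E by (simp add: MW simps)
  finally have "unitary_mat V" using V EdE by (intro unitaryI) simp_all
  moreover have "V * real_diag n s * mat_adjoint W = T"
    using T W E WW by (simp add: V_def simps Es)
  ultimately show thesis
    using that[of V W s] V W pos by (simp add: s_def)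
qed

text \<open>The squares stay written as products, so that the power has the shape
  \<open>R * mat_adjoint R\<close> with \<open>R\<close> equal to \<open>U\<close> times a real
  diagonal matrix.\<close>

lemma mat_powr_diag_sq:
  assumes U: "U \<in> carrier_mat n n" "unitary_mat U" and pos: "\<And>i. i < n \<Longrightarrow> 0 < s i"
  shows "(U * (real_diag n s * real_diag n s) * mat_adjoint U) powr\<^sub>m t
    = U * (real_diag n (\<lambda>i. s i powr t) * real_diag n (\<lambda>i. s i powr t)) * mat_adjoint U"
proof -
  have "real_diag n (\<lambda>i. (s i * s i) powr t) = real_diag n (\<lambda>i. s i powr t * s i powr t)"
    using pos by (intro mat_diag_cong) (simp add: powr_mult)
  then show ?thesis
    using herm_fun_diag[OF U, of "\<lambda>x. x powr t" "\<lambda>i. s i * s i"] by (simp add: mat_powr_def)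
qed

text \<open>\<open>adjoint_am_gm\<close> for \<open>P = X V p\<close> and \<open>Q = X W q\<close>,
  where the singular values are split into \<open>p\<close> and \<open>q\<close> so that the cross
  terms give back \<open>T\<close> and its adjoint.\<close>

lemma loewner_powr_adjoint:
  assumes T: "T \<in> carrier_mat n n" and S: "S \<in> carrier_mat n n" and inv: "S * T = 1\<^sub>m n"
    and X: "X \<in> carrier_mat n n"
  shows "X * T * mat_adjoint X + X * mat_adjoint T * mat_adjoint X \<preceq>\<^sub>L
    X * (T * mat_adjoint T) powr\<^sub>m t * mat_adjoint X
    + X * (mat_adjoint T * T) powr\<^sub>m (1 - t) * mat_adjoint X"
proof -
  note simps = square_mat_simps[where n = n]
  obtain V W s where V: "V \<in> carrier_mat n n" "unitary_mat V" and W: "W \<in> carrier_mat n n" "unitary_mat W"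
    and TV: "T = V * real_diag n s * mat_adjoint W" and pos: "\<And>i. i < n \<Longrightarrow> 0 < s i"
    using singular_value_decomposition[OF T S inv] by blast
  note VV = unitaryD[OF V(2,1)] and WW = unitaryD[OF W(2,1)]
  \<comment> \<open>The exponents \<open>t\<close> and \<open>1 - t\<close> add up to 1, so
    \<open>p * q\<close> is the diagonal matrix of singular values.\<close>
  define p where "p = real_diag n (\<lambda>i. s i powr t)"
  define q where "q = real_diag n (\<lambda>i. s i powr (1 - t))"
  have pq: "p \<in> carrier_mat n n" "q \<in> carrier_mat n n" "mat_adjoint p = p" "mat_adjoint q = q"
    by (simp_all add: p_def q_def)
  have "s i powr t * s i powr (1 - t) = s i" if "i < n" for i
    using pos[OF that] by (simp flip: powr_add)
  then have s: "p * q = real_diag n s" "q * p = real_diag n s"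
    by (auto simp: p_def q_def mult.commute intro!: mat_diag_cong simp flip: of_real_mult)
  have TT: "T * mat_adjoint T = V * (real_diag n s * real_diag n s) * mat_adjoint V"
    using V W WW by (simp add: TV simps del: mat_diag_diag)
  have N: "(T * mat_adjoint T) powr\<^sub>m t = V * (p * p) * mat_adjoint V"
    unfolding TT p_def by (rule mat_powr_diag_sq[OF V pos])
  have TT': "mat_adjoint T * T = W * (real_diag n s * real_diag n s) * mat_adjoint W"
    using V W VV by (simp add: TV simps del: mat_diag_diag)
  have M: "(mat_adjoint T * T) powr\<^sub>m (1 - t) = W * (q * q) * mat_adjoint W"
    unfolding TT' q_def by (rule mat_powr_diag_sq[OF W pos])
  have "T = V * (p * q) * mat_adjoint W" "mat_adjoint T = W * (q * p) * mat_adjoint V"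
    using V W by (simp_all add: TV s simps)
  then show ?thesis
    using adjoint_am_gm[of "X * (V * p)" n "X * (W * q)"] X V W pq
    unfolding N M by (simp add: simps)
qed

section \<open>Eigenvalue comparison for the two means\<close>

theorem theorem3p2:
  fixes A B C :: "complex mat" and n :: nat and t :: real
  assumes "A \<in> carrier_mat n n" and "B \<in> carrier_mat n n" and "C \<in> carrier_mat n n"
    and "pos_def A" and "pos_def B" and "pos_def C"
    and "A + B \<preceq>\<^sub>L C"
    and "0 \<le> t" and "t \<le> 1"
  shows "\<forall>j \<in> {1..n}.
    eigval_dec (C + A powr\<^sub>m (1/2) * B powr\<^sub>m (1/2) + B powr\<^sub>m (1/2) * A powr\<^sub>m (1/2)) j
      \<le> eigval_dec (C + sharp_mean (1 - t) A B + natural_mean t A B) j"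
proof
  fix j assume j: "j \<in> {1..n}"
  note simps = square_mat_simps[where n = n]
  have herm: "hermitian_mat A" "hermitian_mat B" "mat_adjoint C = C"
    using assms by (auto simp: pos_def_def hermitian_mat_def)
  define X where "X = A powr\<^sub>m (1/2)"
  define X' where "X' = A powr\<^sub>m (-1/2)"
  define Y where "Y = B powr\<^sub>m (1/2)"
  define Y' where "Y' = B powr\<^sub>m (-1/2)"
  have carr: "X \<in> carrier_mat n n" "X' \<in> carrier_mat n n" "Y \<in> carrier_mat n n" "Y' \<in> carrier_mat n n"
    and adj: "mat_adjoint X = X" "mat_adjoint X' = X'" "mat_adjoint Y = Y"
    using herm_fun_hermitian[OF assms(1) herm(1)] herm_fun_hermitian[OF assms(2) herm(2)]
    by (simp_all add: X_def X'_def Y_def Y'_def mat_powr_def)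
  have XX: "X * X = A" "X * X' = 1\<^sub>m n" "X' * X = 1\<^sub>m n"
    using mat_powr_half[OF assms(1,4)] by (simp_all add: X_def X'_def)
  have YY: "Y * Y = B" "Y' * Y = 1\<^sub>m n"
    using mat_powr_half[OF assms(2,5)] by (simp_all add: Y_def Y'_def)
  have inv: "the (mat_inverse A) = X' * X'"
    by (rule the_mat_inverse[of _ n]) (use carr XX(2,3) assms(1) in \<open>simp_all add: XX(1)[symmetric] simps\<close>)
  \<comment> \<open>Chosen so that \<open>mat_adjoint T * T\<close> and
    \<open>T * mat_adjoint T\<close> are the matrices whose powers occur in the sharp and the
    natural mean.\<close>
  define T where "T = Y * X'"
  have T: "T \<in> carrier_mat n n" "X * Y' \<in> carrier_mat n n" "X * Y' * T = 1\<^sub>m n"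
    using carr XX YY by (simp_all add: T_def simps)
  have adjT: "mat_adjoint T = X' * Y" using carr by (simp add: T_def simps adj)
  have M: "mat_adjoint T * T = X' * B * X'"
    using carr unfolding adjT by (simp add: T_def YY(1)[symmetric] simps)
  have N: "T * mat_adjoint T = Y * the (mat_inverse A) * Y"
    using carr unfolding adjT by (simp add: T_def inv simps)
  define F where "F = (mat_adjoint T * T) powr\<^sub>m (1 - t)"
  define G where "G = (T * mat_adjoint T) powr\<^sub>m t"
  have FG: "F \<in> carrier_mat n n" "G \<in> carrier_mat n n" "mat_adjoint F = F" "mat_adjoint G = G"
    using herm_fun_hermitian[of "mat_adjoint T * T" n] herm_fun_hermitian[of "T * mat_adjoint T" n] T(1)
    by (simp_all add: F_def G_def mat_powr_def hermitian_mat_def simps)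
  have sharp: "sharp_mean (1 - t) A B = X * F * X"
    by (simp add: sharp_mean_def F_def M X_def X'_def)
  have natural: "natural_mean t A B = X * G * X"
    by (simp add: natural_mean_def G_def N X_def Y_def)
  \<comment> \<open>An outer factor \<open>X\<close> cancels the \<open>X'\<close> inside
    \<open>T\<close>, leaving the mixed products of the left-hand side.\<close>
  have XTX: "X * T * X = X * Y" "X * (mat_adjoint T) * X = Y * X"
    using carr XX unfolding adjT by (simp_all add: T_def simps)
  define L where "L = C + X * Y + Y * X"
  define R where "R = C + X * F * X + X * G * X"
  have L: "L \<in> carrier_mat n n" "hermitian_mat L"
    using carr assms(3) herm(3) adj
    by (auto simp: L_def hermitian_mat_def adjoint_add[of _ n n] simps intro!: eq_matI)
  have R: "R \<in> carrier_mat n n" "hermitian_mat R"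
    using carr assms(3) herm(3) adj FG
    by (auto simp: R_def hermitian_mat_def adjoint_add[of _ n n] simps)
  \<comment> \<open>\<open>C\<close> cancels; the remaining terms are arranged as in
    \<open>loewner_powr_adjoint\<close>.\<close>
  have "R - L = X * G * X + X * F * X - (X * Y + Y * X)"
    unfolding R_def L_def
    by (rule eq_matI) (use carr FG assms(3) in \<open>auto simp del: index_mult_mat(1)\<close>)
  then have "L \<preceq>\<^sub>L R"
    using loewner_powr_adjoint[OF T carr(1), of t]
    by (simp add: loewner_le_def adj XTX F_def G_def)
  from eigval_dec_mono[OF L R this j]
  show "eigval_dec (C + A powr\<^sub>m (1/2) * B powr\<^sub>m (1/2) + B powr\<^sub>m (1/2) * A powr\<^sub>m (1/2)) j
      \<le> eigval_dec (C + sharp_mean (1 - t) A B + natural_mean t A B) j"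
    by (simp add: sharp natural L_def R_def X_def Y_def)
qed

end
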